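(* Let $\Phi=\{\varphi_i\}_{i\in I}$ be a frame for a Hilbert space $\mathbb{H}$ with frame bounds $A,B>0$ and frame operator $S$. If $B/A<2$, then $\Phi$ and the scaled canonical dual frame $\left\{\frac{2AB}{A+B}S^{-1}\varphi_i\right\}_{i\in I}$ are woven. Likewise, if $B/A<2$, then $\Phi$ and the scaled canonical Parseval frame $\left\{\frac{2\sqrt{AB}}{\sqrt{A}+\sqrt{B}}S^{-1/2}\varphi_i\right\}_{i\in I}$ are woven.
   Context: $I$ is a finite or countably infinite index set. A family $\{f_i\}_{i\in J}$ in $\mathbb{H}$ is a frame for $\mathbb H$ with (lower, upper) frame bounds $A,B$ if $0<A\le B<\infty$ and $A\|x\|^2\le \sum_{i\in J}|\langle x,f_i\rangle|^2\le B\|x\|^2$ for all $x\in\mathbb{H}$. The frame operator of a frame $\{\varphi_i\}_{i\in I}$ is the positive, self-adjoint, invertible operator $Sx=\sum_{i\in I}\langle x,\varphi_i\rangle\varphi_i$. Two frames $\{\varphi_i\}_{i\in I}$, $\{\psi_i\}_{i\in I}$ for $\mathbb{H}$ are woven if there are universal constants $0<A'\le B'<\infty$ such that for every $\sigma\subset I$ (with $\sigma^c=I\setminus\sigma$) the indexed family $\{\varphi_i\}_{i\in\sigma}\cup\{\psi_i\}_{i\in\sigma^c}$ is a frame for $\mathbb{H}$ with lower and upper frame bounds $A'$ and $B'$. *)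

theory Defs
  imports "HOL-Analysis.Analysis"
begin

text \<open>
  Scalars: the two standard models are \<open>real\<close> and \<open>complex\<close>, so one statement covers real and
  complex Hilbert spaces. There are no others up to isomorphism: the axioms force
  \<open>x + conjg x\<close> and \<open>x * conjg x\<close> to be real, so every \<open>x\<close> is quadratic over the reals.
\<close>

class rc_scalar = real_normed_field +
  fixes conjg :: "'a \<Rightarrow> 'a"
  assumes conjg_add: "conjg (x + y) = conjg x + conjg y"
    and conjg_mult: "conjg (x * y) = conjg x * conjg y"
    and mult_conjg: "x * conjg x = (norm x)\<^sup>2 *\<^sub>R 1"

instantiation real :: rc_scalar
begin
definition "conjg = (\<lambda>x::real. x)"
instance
  by standard (simp_all add: conjg_real_def power2_eq_square)
end

instantiation complex :: rc_scalar
begin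
definition "conjg = cnj"
instance
  by standard (simp_all add: conjg_complex_def scaleR_conv_of_real complex_norm_square[symmetric])
end

text \<open>
  Completeness, the norm and the topology come from the class \<open>banach\<close>; the inner product
  is linear in its first argument and induces the norm.
\<close>

locale hilbert_space = vector_space smul
  for smul :: "'k::rc_scalar \<Rightarrow> 'h::banach \<Rightarrow> 'h" +
  fixes ip :: "'h \<Rightarrow> 'h \<Rightarrow> 'k"
  assumes scale_of_real: "smul (of_real r) x = r *\<^sub>R x"
    and ip_add_left: "ip (x + y) z = ip x z + ip y z"
    and ip_scale_left: "ip (smul c x) y = c * ip x y"
    and ip_commute: "ip y x = conjg (ip x y)"
    and ip_self: "ip x x = of_real ((norm x)\<^sup>2)"

text \<open>
  Summability is required explicitly because \<open>infsum\<close> is \<open>0\<close> on families that are not summable.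
\<close>

definition frame_with_bounds ::
    "('h \<Rightarrow> 'h \<Rightarrow> 'k::rc_scalar) \<Rightarrow> 'i set \<Rightarrow> ('i \<Rightarrow> 'h::banach) \<Rightarrow> real \<Rightarrow> real \<Rightarrow> bool"
  where "frame_with_bounds ip J f A B \<longleftrightarrow>
    0 < A \<and> A \<le> B \<and>
    (\<forall>x. (\<lambda>i. (norm (ip x (f i)))\<^sup>2) summable_on J \<and>
         A * (norm x)\<^sup>2 \<le> (\<Sum>\<^sub>\<infinity>i\<in>J. (norm (ip x (f i)))\<^sup>2) \<and>
         (\<Sum>\<^sub>\<infinity>i\<in>J. (norm (ip x (f i)))\<^sup>2) \<le> B * (norm x)\<^sup>2)"

definition frame_operator ::
    "('k::rc_scalar \<Rightarrow> 'h::banach \<Rightarrow> 'h) \<Rightarrow> ('h \<Rightarrow> 'h \<Rightarrow> 'k) \<Rightarrow> 'i set \<Rightarrow> ('i \<Rightarrow> 'h) \<Rightarrow> 'h \<Rightarrow> 'h"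
  where "frame_operator smul ip J f x = (\<Sum>\<^sub>\<infinity>i\<in>J. smul (ip x (f i)) (f i))"

text \<open>
  That \<open>\<phi>\<close> and \<open>\<psi>\<close> are themselves frames is the case \<open>\<sigma> = I\<close>, respectively \<open>\<sigma> = {}\<close>.
\<close>

definition woven ::
    "('h \<Rightarrow> 'h \<Rightarrow> 'k::rc_scalar) \<Rightarrow> 'i set \<Rightarrow> ('i \<Rightarrow> 'h::banach) \<Rightarrow> ('i \<Rightarrow> 'h) \<Rightarrow> bool"
  where "woven ip I \<phi> \<psi> \<longleftrightarrow>
    (\<exists>A' B'. 0 < A' \<and> A' \<le> B' \<and>
      (\<forall>\<sigma>. \<sigma> \<subseteq> I \<longrightarrow> frame_with_bounds ip I (\<lambda>i. if i \<in> \<sigma> then \<phi> i else \<psi> i) A' B'))"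

text \<open>
  Over the reals self-adjointness does not follow from nonnegativity of the quadratic form,
  so it is part of the definition.
\<close>

definition positive_operator ::
    "('k::rc_scalar \<Rightarrow> 'h::banach \<Rightarrow> 'h) \<Rightarrow> ('h \<Rightarrow> 'h \<Rightarrow> 'k) \<Rightarrow> ('h \<Rightarrow> 'h) \<Rightarrow> bool"
  where "positive_operator smul ip T \<longleftrightarrow>
    bounded_linear T \<and> (\<forall>c x. T (smul c x) = smul c (T x)) \<and>
    (\<forall>x y. ip (T x) y = ip x (T y)) \<and>
    (\<forall>x. \<exists>r\<ge>0. ip (T x) x = of_real r)"

definition positive_sqrt ::
    "('k::rc_scalar \<Rightarrow> 'h::banach \<Rightarrow> 'h) \<Rightarrow> ('h \<Rightarrow> 'h \<Rightarrow> 'k) \<Rightarrow> ('h \<Rightarrow> 'h) \<Rightarrow> 'h \<Rightarrow> 'h"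
  where "positive_sqrt smul ip T =
    (THE R. positive_operator smul ip R \<and> R \<circ> R = T)"

end

theory Submission
  imports Defs
begin

text \<open>
  Let \<open>S\<close> be the frame operator and \<open>U\<close> a bounded self-adjoint operator with
  \<open>Re \<langle>Sx,Ux\<rangle> \<ge> \<delta>\<parallel>x\<parallel>\<^sup>2\<close>. Since \<open>\<langle>x,U\<phi>\<^sub>i\<rangle> = \<langle>Ux,\<phi>\<^sub>i\<rangle>\<close>, the pairing \<open>\<langle>Sx,Ux\<rangle>\<close> is the \<open>\<ell>\<^sup>2\<close> inner
  product of the coefficients of \<open>x\<close> against \<open>\<phi>\<close> with those against \<open>U\<phi>\<close>. It is large, and each of
  its terms contains both coefficients with the same index. Hence \<open>x\<close> cannot have small
  coefficients against \<open>\<phi>\<close> on a set of indices and also against \<open>U\<phi>\<close> on the complement. With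
  Bessel bounds for both families this gives a lower bound independent of the partition:
  \<open>\<phi>\<close> and \<open>U\<phi>\<close> are woven (\<open>woven_symmetric_image\<close>). Positive multiples of \<open>U\<close> inherit the condition.

  For \<open>U = S\<^sup>-\<^sup>1\<close> the pairing is \<open>\<parallel>x\<parallel>\<^sup>2\<close>. For \<open>U = S\<^sup>-\<^sup>1\<^sup>/\<^sup>2\<close> it is \<open>\<langle>S\<^sup>1\<^sup>/\<^sup>2x,x\<rangle>\<close>, which is bounded below
  because \<open>S\<close> is.

  It remains to have \<open>S\<^sup>-\<^sup>1\<close> and \<open>S\<^sup>-\<^sup>1\<^sup>/\<^sup>2\<close> at hand as bounded self-adjoint operators. Both come from the
  remark that a bounded operator \<open>T\<close> with \<open>Re \<langle>Tx,x\<rangle> \<ge> \<delta>\<parallel>x\<parallel>\<^sup>2\<close> has a positive multiple at distance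
  less than one from the identity (\<open>coercive_near_identity\<close>): Banach's fixed point theorem then solves
  \<open>Tx = y\<close>, and, for self-adjoint \<open>T\<close>, it solves \<open>R\<^sup>2 = T\<close> inside the bicommutant of \<open>T\<close>. That location
  of \<open>R\<close> makes the positive root unique and linear over the scalar field at the same time,
  since scalar multiplications commute with \<open>T\<close>. The operator theory therefore takes place in the
  underlying real Hilbert space.
\<close>

section \<open>Unconditional Cauchy criterion\<close>

text \<open>
  In infinite dimension the terms of a frame expansion need not be absolutely summable, so the
  partial sums themselves have to be shown to be Cauchy.
\<close>

lemma summable_on_banach_CauchyI:
  fixes f :: "'i \<Rightarrow> 'b::banach"
  assumes "\<And>e. e > 0 \<Longrightarrow> \<exists>F0. finite F0 \<and> F0 \<subseteq> A \<and>
             (\<forall>F. finite F \<longrightarrow> F \<subseteq> A - F0 \<longrightarrow> norm (sum f F) < e)"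
  shows "f summable_on A"
proof -
  have "\<exists>P. eventually P (finite_subsets_at_top A) \<and>
              (\<forall>F F'. P F \<and> P F' \<longrightarrow> dist (sum f F) (sum f F') < e)" if "e > 0" for e
  proof -
    obtain F0 where F0: "finite F0" "F0 \<subseteq> A"
      and small: "\<And>F. finite F \<Longrightarrow> F \<subseteq> A - F0 \<Longrightarrow> norm (sum f F) < e / 2"
      using assms[of "e / 2"] \<open>e > 0\<close> by auto
    define P where "P F \<longleftrightarrow> finite F \<and> F0 \<subseteq> F \<and> F \<subseteq> A" for F
    have ev: "eventually P (finite_subsets_at_top A)"
      unfolding eventually_finite_subsets_at_top P_def using F0 by blast
    have near: "dist (sum f F) (sum f F0) < e / 2" if "P F" for F
    proof -
      have "sum f F - sum f F0 = sum f (F - F0)"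
        using that F0 by (simp add: P_def sum_diff)
      moreover have "norm (sum f (F - F0)) < e / 2"
        using that by (intro small) (auto simp: P_def)
      ultimately show ?thesis by (simp add: dist_norm)
    qed
    have "dist (sum f F) (sum f F') < e" if "P F" "P F'" for F F'
      using near[OF that(1)] near[OF that(2)] by (rule dist_triangle_half_l)
    then show ?thesis using ev by blast
  qed
  then have "cauchy_filter (filtermap (sum f) (finite_subsets_at_top A))"
    by (simp add: cauchy_filter_metric_filtermap)
  moreover have "complete (UNIV :: 'b set)"
    by (meson Cauchy_convergent UNIV_I complete_def convergent_def)
  ultimately obtain L where "(sum f \<longlongrightarrow> L) (finite_subsets_at_top A)"
    using complete_uniform[where S = UNIV] by (force simp add: filterlim_def)
  then show ?thesis
    using summable_on_def has_sum_def by blast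
qed

section \<open>Coercive operators on a real Hilbert space\<close>

locale real_hilbert =
  fixes g :: "'h::banach \<Rightarrow> 'h \<Rightarrow> real"
  assumes add_left: "g (x + y) z = g x z + g y z"
    and scaleR_left: "g (r *\<^sub>R x) y = r * g x y"
    and commute: "g x y = g y x"
    and self: "g x x = (norm x)\<^sup>2"
begin

lemma add_right: "g x (y + z) = g x y + g x z"
  by (metis add_left commute)

lemma scaleR_right: "g x (r *\<^sub>R y) = r * g x y"
  by (metis scaleR_left commute)

lemma minus_left: "g (- x) y = - g x y"
  using scaleR_left[of "-1" x y] by simp

lemma minus_right: "g x (- y) = - g x y"
  by (metis minus_left commute)

lemma diff_left: "g (x - y) z = g x z - g y z"
  using add_left[of x "- y" z] by (simp add: minus_left)

lemma diff_right: "g x (y - z) = g x y - g x z"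
  by (metis diff_left commute)

lemma zero_left: "g 0 y = 0"
  using scaleR_left[of 0 0 y] by simp

lemma zero_right: "g x 0 = 0"
  by (metis zero_left commute)

lemmas bilinear = add_left add_right scaleR_left scaleR_right diff_left diff_right
  minus_left minus_right zero_left zero_right

lemma norm_add_square: "(norm (x + y))\<^sup>2 = (norm x)\<^sup>2 + 2 * g x y + (norm y)\<^sup>2"
  by (simp add: self[symmetric] add_left add_right commute[of y x])

lemma norm_diff_square: "(norm (x - y))\<^sup>2 = (norm x)\<^sup>2 - 2 * g x y + (norm y)\<^sup>2"
  using norm_add_square[of x "- y"] by (simp add: minus_right)

text \<open>
  Expanding the square of the triangle inequality yields Cauchy--Schwarz, since the norm is
  already known to be one.
\<close>

lemma cauchy_schwarz: "\<bar>g x y\<bar> \<le> norm x * norm y"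
proof -
  have upper: "g u v \<le> norm u * norm v" for u v
  proof -
    have "(norm (u + v))\<^sup>2 \<le> (norm u + norm v)\<^sup>2"
      by (intro power_mono norm_triangle_ineq) simp
    then show ?thesis
      by (simp add: norm_add_square power2_sum)
  qed
  show ?thesis
    using upper[of x y] upper[of "- x" y] by (simp add: minus_left abs_le_iff)
qed

lemma bounded_linear_left: "bounded_linear (\<lambda>x. g x y)"
  by (rule bounded_linear_intro[where K = "norm y"])
    (use cauchy_schwarz in \<open>simp_all add: bilinear\<close>)

lemma bounded_linear_right: "bounded_linear (\<lambda>y. g x y)"
  using bounded_linear_left[of x] by (simp add: commute[of x])

definition coercive :: "real \<Rightarrow> ('h \<Rightarrow> 'h) \<Rightarrow> bool"
  where "coercive \<delta> T \<longleftrightarrow> \<delta> > 0 \<and> (\<forall>x. \<delta> * (norm x)\<^sup>2 \<le> g (T x) x)"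

definition symmetric :: "('h \<Rightarrow> 'h) \<Rightarrow> bool"
  where "symmetric T \<longleftrightarrow> (\<forall>x y. g (T x) y = g x (T y))"

lemma coercive_norm_lower_bound:
  assumes "coercive \<delta> T"
  shows "\<delta> * norm x \<le> norm (T x)"
proof (cases "x = 0")
  case False
  have "\<delta> * (norm x)\<^sup>2 \<le> g (T x) x"
    using assms by (simp add: coercive_def)
  also have "\<dots> \<le> norm (T x) * norm x"
    using cauchy_schwarz[of "T x" x] by linarith
  finally have "(\<delta> * norm x) * norm x \<le> norm (T x) * norm x"
    by (simp add: power2_eq_square mult.assoc)
  with False show ?thesis by simp
qed simp

text \<open>
  With a bound \<open>K\<close> for \<open>T\<close>, the expansion
  \<open>\<parallel>x - tTx\<parallel>\<^sup>2 = \<parallel>x\<parallel>\<^sup>2 - 2t\<langle>Tx,x\<rangle> + t\<^sup>2\<parallel>Tx\<parallel>\<^sup>2 \<le> (1 - 2t\<delta> + t\<^sup>2K\<^sup>2)\<parallel>x\<parallel>\<^sup>2\<close> has its smallest right-hand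
  side at \<open>t = \<delta>/K\<^sup>2\<close>. Coercive operators are thus perturbations of multiples of the
  identity, which gives access to Banach's fixed point theorem in place of a spectral calculus.
\<close>

lemma coercive_near_identity:
  assumes T: "bounded_linear T" and co: "coercive \<delta> T"
  obtains t r where "t > 0" "0 \<le> r" "r < 1" "\<And>x. norm (x - t *\<^sub>R T x) \<le> r * norm x"
proof -
  obtain K0 where K0: "K0 > 0" "\<And>x. norm (T x) \<le> norm x * K0"
    using bounded_linear.pos_bounded[OF T] by blast
  (* Enlarging the bound to at least \<delta> keeps 1 - (\<delta> / K)^2 nonnegative on the zero space too. *)
  define K where "K = max K0 \<delta>"
  have \<delta>: "\<delta> > 0" "\<And>x. \<delta> * (norm x)\<^sup>2 \<le> g (T x) x"
    using co by (auto simp: coercive_def)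
  have K: "K > 0" "\<delta> \<le> K"
    using K0(1) by (auto simp: K_def)
  have bound: "norm (T x) \<le> K * norm x" for x
    using K0(2)[of x] mult_left_mono[of K0 K "norm x"] by (simp add: K_def mult.commute)
  define t where "t = \<delta> / K\<^sup>2"
  define r where "r = sqrt (1 - (\<delta> / K)\<^sup>2)"
  have t: "t > 0" using \<delta> K by (simp add: t_def)
  have ratio: "0 < \<delta> / K" "\<delta> / K \<le> 1" using \<delta> K by auto
  then have sq: "0 < (\<delta> / K)\<^sup>2" "(\<delta> / K)\<^sup>2 \<le> 1"
    by (auto simp: power_le_one)
  have r: "0 \<le> r" "r < 1" and r2: "r\<^sup>2 = 1 - (\<delta> / K)\<^sup>2"
    using sq by (auto simp: r_def real_less_lsqrt)
  have "norm (x - t *\<^sub>R T x) \<le> r * norm x" for x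
  proof (rule power2_le_imp_le)
    have "(norm (x - t *\<^sub>R T x))\<^sup>2 = (norm x)\<^sup>2 - 2 * t * g (T x) x + t\<^sup>2 * (norm (T x))\<^sup>2"
      by (simp add: norm_diff_square bilinear commute[of x] power_mult_distrib)
    also have "\<dots> \<le> (norm x)\<^sup>2 - 2 * t * (\<delta> * (norm x)\<^sup>2) + t\<^sup>2 * (K * norm x)\<^sup>2"
      using \<delta>(2)[of x] bound[of x] t by (intro add_mono diff_mono mult_left_mono power_mono) auto
    also have "\<dots> = (1 - (\<delta> / K)\<^sup>2) * (norm x)\<^sup>2"
      using K by (simp add: t_def field_simps power2_eq_square)
    finally show "(norm (x - t *\<^sub>R T x))\<^sup>2 \<le> (r * norm x)\<^sup>2"
      by (simp add: power_mult_distrib r2)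
  qed (use r in simp)
  with t r that show thesis by blast
qed

text \<open>
  A solution of \<open>Tx = y\<close> is a fixed point of the contraction \<open>x \<mapsto> x - t(Tx - y)\<close>.
\<close>

lemma coercive_bij:
  assumes T: "bounded_linear T" and co: "coercive \<delta> T"
  shows "bij T"
proof -
  interpret T: bounded_linear T by fact
  have \<delta>: "\<delta> > 0" using co by (simp add: coercive_def)
  have "inj T"
  proof (rule injI)
    fix x y assume "T x = T y"
    then have "\<delta> * norm (x - y) \<le> 0"
      using coercive_norm_lower_bound[OF co, of "x - y"] by (simp add: T.diff)
    with \<delta> show "x = y" by (simp add: mult_le_0_iff)
  qed
  moreover have "\<exists>x. y = T x" for y
  proof -
    obtain t r where t: "t > 0" and r: "0 \<le> r" "r < 1"
      and contr: "\<And>x. norm (x - t *\<^sub>R T x) \<le> r * norm x"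
      using coercive_near_identity[OF T co] by blast
    have "\<exists>!x. x - t *\<^sub>R (T x - y) = x"
    proof (rule banach_fix_type[OF r], intro allI)
      fix u v
      have eq: "u - t *\<^sub>R (T u - y) - (v - t *\<^sub>R (T v - y)) = (u - v) - t *\<^sub>R T (u - v)"
        by (simp add: T.diff algebra_simps)
      show "dist (u - t *\<^sub>R (T u - y)) (v - t *\<^sub>R (T v - y)) \<le> r * dist u v"
        unfolding dist_norm eq by (rule contr)
    qed
    then obtain x where "x - t *\<^sub>R (T x - y) = x" by blast
    with t have "T x - y = 0" by simp
    then show ?thesis by (intro exI[of _ x]) simp
  qed
  ultimately show ?thesis by (auto simp: bij_def surj_def)
qed

lemma bounded_linear_inv_coercive:
  assumes T: "bounded_linear T" and co: "coercive \<delta> T"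
  shows "bounded_linear (inv T)"
proof -
  interpret T: bounded_linear T by fact
  have bij: "bij T" by (rule coercive_bij[OF assms])
  have \<delta>: "\<delta> > 0" using co by (simp add: coercive_def)
  have TI: "T (inv T y) = y" for y using bij by (simp add: bij_is_surj surj_f_inv_f)
  have IT: "inv T y = x" if "T x = y" for x y using bij that by (auto simp: bij_is_inj)
  show ?thesis
  proof (rule bounded_linear_intro[where K = "1 / \<delta>"])
    show "inv T (x + y) = inv T x + inv T y" for x y
      by (rule IT) (simp add: T.add TI)
    show "inv T (r *\<^sub>R x) = r *\<^sub>R inv T x" for r x
      by (rule IT) (simp add: T.scaleR TI)
    show "norm (inv T x) \<le> norm x * (1 / \<delta>)" for x
      using coercive_norm_lower_bound[OF co, of "inv T x"] \<delta> by (simp add: TI field_simps)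
  qed
qed

lemma symmetric_inv:
  assumes "symmetric T" "surj T"
  shows "symmetric (inv T)"
  unfolding symmetric_def
proof (intro allI)
  fix x y
  have "g (inv T x) y = g (inv T x) (T (inv T y))"
    using assms(2) by (simp add: surj_f_inv_f)
  also have "\<dots> = g (T (inv T x)) (inv T y)"
    using assms(1) by (simp add: symmetric_def)
  also have "\<dots> = g x (inv T y)"
    using assms(2) by (simp add: surj_f_inv_f)
  finally show "g (inv T x) y = g x (inv T y)" .
qed

lemma coercive_inv:
  assumes T: "bounded_linear T" and co: "coercive \<delta> T"
  obtains \<epsilon> where "coercive \<epsilon> (inv T)"
proof -
  have bij: "bij T" by (rule coercive_bij[OF assms])
  have \<delta>: "\<delta> > 0" "\<And>x. \<delta> * (norm x)\<^sup>2 \<le> g (T x) x"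
    using co by (auto simp: coercive_def)
  obtain K where K: "K > 0" "\<And>x. norm (T x) \<le> norm x * K"
    using bounded_linear.pos_bounded[OF T] by blast
  have TI: "T (inv T y) = y" for y using bij by (simp add: bij_is_surj surj_f_inv_f)
  have "(\<delta> / K\<^sup>2) * (norm y)\<^sup>2 \<le> g (inv T y) y" for y
  proof -
    have "(norm y)\<^sup>2 \<le> (norm (inv T y) * K)\<^sup>2"
      using K(2)[of "inv T y"] by (intro power_mono) (simp_all add: TI)
    then have "(\<delta> / K\<^sup>2) * (norm y)\<^sup>2 \<le> (\<delta> / K\<^sup>2) * (norm (inv T y) * K)\<^sup>2"
      using \<delta> by (intro mult_left_mono) simp_all
    also have "\<dots> = \<delta> * (norm (inv T y))\<^sup>2"
      using K(1) by (simp add: power_mult_distrib)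
    also have "\<dots> \<le> g (inv T y) y"
      using \<delta>(2)[of "inv T y"] by (simp add: TI commute)
    finally show ?thesis .
  qed
  then have "coercive (\<delta> / K\<^sup>2) (inv T)"
    using \<delta> K by (simp add: coercive_def)
  then show thesis by (rule that)
qed

section \<open>Positive square roots without spectral calculus\<close>

text \<open>
  With \<open>Z = 1 - tT\<close> and \<open>\<parallel>Z\<parallel> \<le> r < 1\<close>, a root of \<open>tT\<close> has the form \<open>1 - Y\<close> where
  \<open>Y = (Z + Y\<^sup>2)/2\<close>. The right-hand side maps the ball of radius \<open>r\<close> to itself and
  contracts it, so Banach's fixed point theorem provides \<open>Y\<close>. Being symmetric and commuting with
  the commutant of \<open>T\<close> are closed conditions that this map preserves; they are therefore
  built into the set on which the fixed point is taken.
\<close>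

lemma coercive_sqrt_exists:
  assumes T: "bounded_linear T" and co: "coercive \<delta> T" and sym: "symmetric T"
  obtains R \<epsilon> where "bounded_linear R" "coercive \<epsilon> R" "symmetric R" "R \<circ> R = T"
    "\<And>W. bounded_linear W \<Longrightarrow> W \<circ> T = T \<circ> W \<Longrightarrow> W \<circ> R = R \<circ> W"
proof -
  interpret T: bounded_linear T by fact
  obtain t r where t: "t > 0" and r: "0 \<le> r" "r < 1"
    and contr: "\<And>x. norm (x - t *\<^sub>R T x) \<le> r * norm x"
    using coercive_near_identity[OF T co] by blast
  define Z where "Z = Blinfun (\<lambda>x. x - t *\<^sub>R T x)"
  have "bounded_linear (\<lambda>x. x - t *\<^sub>R T x)"
    by (intro bounded_linear_sub bounded_linear_ident bounded_linear_scaleR_right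
        bounded_linear_compose[OF bounded_linear_scaleR_right T])
  then have Z: "blinfun_apply Z x = x - t *\<^sub>R T x" for x
    by (simp add: Z_def bounded_linear_Blinfun_apply)
  have normZ: "norm Z \<le> r"
    by (rule norm_blinfun_bound) (use r contr in \<open>simp_all add: Z\<close>)
  define M :: "('h \<Rightarrow>\<^sub>L 'h) set" where
    "M = {Y. norm Y \<le> r \<and> (\<forall>x y. g (blinfun_apply Y x) y = g x (blinfun_apply Y y)) \<and>
      (\<forall>W x. bounded_linear W \<longrightarrow> W \<circ> T = T \<circ> W \<longrightarrow>
        W (blinfun_apply Y x) = blinfun_apply Y (W x))}"
  define f :: "('h \<Rightarrow>\<^sub>L 'h) \<Rightarrow> ('h \<Rightarrow>\<^sub>L 'h)" where "f Y = (1 / 2) *\<^sub>R (Z + (Y o\<^sub>L Y))" for Y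
  have f: "blinfun_apply (f Y) x = (1 / 2) *\<^sub>R (Z x + Y (Y x))" for Y x
    by (simp add: f_def blinfun.bilinear_simps)
  have "\<exists>!Y\<in>M. f Y = Y"
  proof (rule Banach_fix)
    have cont: "continuous_on UNIV (\<lambda>Y. blinfun_apply Y x)" for x :: 'h
      by (intro continuous_intros)
    have "closed M"
    proof -
      have "closed {Y :: 'h \<Rightarrow>\<^sub>L 'h. norm Y \<le> r}"
        by (intro closed_Collect_le continuous_intros)
      moreover have "closed {Y :: 'h \<Rightarrow>\<^sub>L 'h. g (blinfun_apply Y x) y = g x (blinfun_apply Y y)}" for x y
        by (intro closed_Collect_eq cont
            bounded_linear.continuous_on[OF bounded_linear_left]
            bounded_linear.continuous_on[OF bounded_linear_right])
      moreover have "closed {Y :: 'h \<Rightarrow>\<^sub>L 'h. bounded_linear W \<longrightarrow> W \<circ> T = T \<circ> W \<longrightarrow>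
          W (blinfun_apply Y x) = blinfun_apply Y (W x)}"
        for W x
      proof (cases "bounded_linear W \<and> W \<circ> T = T \<circ> W")
        case True
        then have W: "bounded_linear W" by simp
        have "closed {Y :: 'h \<Rightarrow>\<^sub>L 'h. W (blinfun_apply Y x) = blinfun_apply Y (W x)}"
          by (intro closed_Collect_eq cont bounded_linear.continuous_on[OF W])
        with True show ?thesis by simp
      next
        case False
        then show ?thesis by (auto simp: imp_conjL[symmetric] simp del: imp_conjL)
      qed
      ultimately show ?thesis
        unfolding M_def by (intro closed_Collect_conj closed_Collect_all)
    qed
    then show "complete M" by (simp add: complete_eq_closed)
    have "0 \<in> M"
      using r by (auto simp: M_def bilinear linear_simps(3))
    then show "M \<noteq> {}" by blast
    show "0 \<le> r" "r < 1" by fact+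
    show "f ` M \<subseteq> M"
    proof
      fix X assume "X \<in> f ` M"
      then obtain Y where Y: "Y \<in> M" and X: "X = f Y" by blast
      have nY: "norm Y \<le> r" and sY: "\<And>x y. g (Y x) y = g x (Y y)"
        and cY: "\<And>W x. bounded_linear W \<Longrightarrow> W \<circ> T = T \<circ> W \<Longrightarrow> W (Y x) = Y (W x)"
        using Y by (auto simp: M_def)
      have "norm (Y o\<^sub>L Y) \<le> norm Y * norm Y"
        by (rule norm_blinfun_compose)
      also have "\<dots> \<le> r * 1"
        using nY r by (intro mult_mono) auto
      finally have "norm (Y o\<^sub>L Y) \<le> r" by simp
      then have "norm (Z + (Y o\<^sub>L Y)) \<le> r + r"
        by (intro norm_triangle_le add_mono normZ)
      then have "norm X \<le> r"
        by (simp add: X f_def)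
      moreover have "g (X x) y = g x (X y)" for x y
        using sym by (simp add: X f Z bilinear sY symmetric_def)
      moreover have "W (X x) = X (W x)" if W: "bounded_linear W" "W \<circ> T = T \<circ> W" for W x
      proof -
        have "W (T x) = T (W x)" for x
          using W(2) by (metis comp_apply)
        then show ?thesis
          using W by (simp add: X f Z cY linear_simps)
      qed
      ultimately show "X \<in> M" by (simp add: M_def)
    qed
    show "dist (f Y) (f Y') \<le> r * dist Y Y'" if "Y \<in> M" "Y' \<in> M" for Y Y'
    proof -
      have n: "norm Y \<le> r" "norm Y' \<le> r" using that by (auto simp: M_def)
      have "(Y o\<^sub>L Y) - (Y' o\<^sub>L Y') = (Y o\<^sub>L (Y - Y')) + ((Y - Y') o\<^sub>L Y')"
        by (rule blinfun_eqI) (simp add: blinfun.bilinear_simps)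
      then have "norm ((Y o\<^sub>L Y) - (Y' o\<^sub>L Y')) \<le> norm (Y o\<^sub>L (Y - Y')) + norm ((Y - Y') o\<^sub>L Y')"
        by (simp add: norm_triangle_ineq)
      also have "\<dots> \<le> norm Y * norm (Y - Y') + norm (Y - Y') * norm Y'"
        by (intro add_mono norm_blinfun_compose)
      also have "\<dots> \<le> r * norm (Y - Y') + norm (Y - Y') * r"
        using n by (intro add_mono mult_mono) (auto simp: r)
      finally have "norm ((Y o\<^sub>L Y) - (Y' o\<^sub>L Y')) \<le> 2 * (r * norm (Y - Y'))" by simp
      moreover have "f Y - f Y' = (1 / 2) *\<^sub>R ((Y o\<^sub>L Y) - (Y' o\<^sub>L Y'))"
        by (simp add: f_def algebra_simps)
      ultimately show ?thesis by (simp add: dist_norm)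
    qed
  qed
  then obtain Y where Y: "Y \<in> M" and fixed: "f Y = Y" by blast
  have nY: "norm Y \<le> r" and sY: "\<And>x y. g (Y x) y = g x (Y y)"
    and cY: "\<And>W x. bounded_linear W \<Longrightarrow> W \<circ> T = T \<circ> W \<Longrightarrow> W (Y x) = Y (W x)"
    using Y by (auto simp: M_def)
  (* (1 - Y)^2 = t T, so the root of T is 1 - Y divided by sqrt t. *)
  define s where "s = 1 / sqrt t"
  have s: "s > 0" "s * s * t = 1"
    using t by (auto simp: s_def field_simps)
  define R where "R x = s *\<^sub>R (x - Y x)" for x
  have "bounded_linear (\<lambda>x. x - Y x)"
    by (intro bounded_linear_sub bounded_linear_ident blinfun.bounded_linear_right)
  then have R: "bounded_linear R"
    unfolding R_def by (rule bounded_linear_compose[OF bounded_linear_scaleR_right])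
  have YY: "Y (Y x) = 2 *\<^sub>R Y x - (x - t *\<^sub>R T x)" for x
  proof -
    have "2 *\<^sub>R Y x = 2 *\<^sub>R f Y x" by (simp add: fixed)
    then show ?thesis by (simp add: f Z)
  qed
  have "R (R x) = T x" for x
  proof -
    have "R (R x) = (s * s * t) *\<^sub>R T x"
      by (simp add: R_def blinfun.bilinear_simps YY algebra_simps scaleR_2)
    then show ?thesis by (simp add: s)
  qed
  then have RR: "R \<circ> R = T" by (simp add: fun_eq_iff)
  have "s * (1 - r) * (norm x)\<^sup>2 \<le> g (R x) x" for x
  proof -
    have "g (Y x) x \<le> norm (Y x) * norm x"
      using cauchy_schwarz[of "Y x" x] by linarith
    also have "\<dots> \<le> (r * norm x) * norm x"
      using norm_blinfun[of Y x] mult_right_mono[OF nY, of "norm x"]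
      by (intro mult_right_mono) auto
    finally have "(1 - r) * (norm x)\<^sup>2 \<le> g (x - Y x) x"
      by (simp add: bilinear self power2_eq_square algebra_simps)
    then have "s * ((1 - r) * (norm x)\<^sup>2) \<le> s * g (x - Y x) x"
      using s by (intro mult_left_mono) auto
    then show ?thesis by (simp add: R_def scaleR_left)
  qed
  then have "coercive (s * (1 - r)) R"
    using s r by (simp add: coercive_def)
  moreover have "symmetric R"
    by (simp add: symmetric_def R_def bilinear sY)
  moreover have "W \<circ> R = R \<circ> W" if W: "bounded_linear W" "W \<circ> T = T \<circ> W" for W
    using cY[OF W] W(1) by (simp add: fun_eq_iff R_def linear_simps)
  ultimately show thesis
    using that R RR by blast
qed

text \<open>
  A competing root \<open>Q\<close> commutes with \<open>Q \<circ> Q = T\<close>, hence with \<open>R\<close>, so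
  \<open>(R + Q)(R - Q) = R\<^sup>2 - Q\<^sup>2 = 0\<close>; coercivity of \<open>R + Q\<close> forces \<open>R = Q\<close>.
\<close>

lemma coercive_sqrt_unique:
  assumes R: "bounded_linear R" and co: "coercive \<epsilon> R" and RR: "R \<circ> R = T"
    and comm: "\<And>W. bounded_linear W \<Longrightarrow> W \<circ> T = T \<circ> W \<Longrightarrow> W \<circ> R = R \<circ> W"
    and Q: "bounded_linear Q" and pos: "\<And>x. 0 \<le> g (Q x) x" and QQ: "Q \<circ> Q = T"
  shows "Q = R"
proof
  fix x
  interpret R: bounded_linear R by fact
  interpret Q: bounded_linear Q by fact
  have QR: "Q (R y) = R (Q y)" for y
    using comm[OF Q] QQ by (metis comp_apply comp_assoc)
  have QQRR: "Q (Q y) = R (R y)" for y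
    using RR QQ by (metis comp_apply)
  define v where "v = R x - Q x"
  have "R v + Q v = 0"
    by (simp add: v_def R.diff Q.diff QR QQRR)
  then have "g (R v) v + g (Q v) v = 0"
    by (simp add: add_left[symmetric] zero_left)
  moreover have "\<epsilon> > 0" "\<epsilon> * (norm v)\<^sup>2 \<le> g (R v) v"
    using co by (auto simp: coercive_def)
  ultimately have "\<epsilon> * (norm v)\<^sup>2 \<le> 0"
    using pos[of v] by linarith
  with \<open>\<epsilon> > 0\<close> show "Q x = R x"
    by (simp add: v_def mult_le_0_iff)
qed

end

section \<open>The real part of the inner product\<close>

text \<open>
  That \<open>conjg\<close> is an isometric involution fixing the reals follows by cancelling in \<open>z * conjg z = \<bar>z\<bar>\<^sup>2\<close>.
\<close>

lemma conjg_zero: "conjg (0 :: 'k::rc_scalar) = 0"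
  using conjg_add[of "0::'k" 0] by simp

lemma conjg_of_real: "conjg (of_real r :: 'k::rc_scalar) = of_real r"
proof (cases "r = 0")
  case False
  have "of_real r * conjg (of_real r :: 'k) = of_real r * of_real r"
    by (simp add: mult_conjg scaleR_conv_of_real power2_eq_square)
  with False show ?thesis by simp
qed (simp add: conjg_zero)

lemma mult_conjg_of_real: "(z :: 'k::rc_scalar) * conjg z = of_real ((norm z)\<^sup>2)"
  by (simp add: mult_conjg scaleR_conv_of_real)

lemma norm_conjg: "norm (conjg z) = norm (z :: 'k::rc_scalar)"
proof (cases "z = 0")
  case False
  have "norm (z * conjg z) = (norm z)\<^sup>2"
    by (simp only: mult_conjg_of_real norm_of_real) simp
  with False show ?thesis by (simp add: norm_mult power2_eq_square)
qed (simp add: conjg_zero)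

lemma conjg_conjg: "conjg (conjg z) = (z :: 'k::rc_scalar)"
proof (cases "z = 0")
  case False
  have "conjg z * conjg (conjg z) = z * conjg z"
    by (simp add: mult_conjg_of_real norm_conjg)
  moreover have "conjg z \<noteq> 0"
    using False norm_conjg[of z] by auto
  ultimately show ?thesis by (simp add: mult.commute[of z])
qed (simp add: conjg_zero)

context hilbert_space
begin

lemma ip_add_right: "ip x (y + z) = ip x y + ip x z"
  by (metis ip_commute ip_add_left conjg_add)

lemma ip_scale_right: "ip x (smul c y) = conjg c * ip x y"
  by (metis ip_commute ip_scale_left conjg_mult)

lemma ip_scaleR_left: "ip (r *\<^sub>R x) y = of_real r * ip x y"
  by (simp add: scale_of_real[symmetric] ip_scale_left)

lemma ip_scaleR_right: "ip x (r *\<^sub>R y) = of_real r * ip x y"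
  by (simp add: scale_of_real[symmetric] ip_scale_right conjg_of_real)

lemma ip_diff_left: "ip (x - y) z = ip x z - ip y z"
  using ip_add_left[of "x - y" y z] by simp

lemma ip_diff_right: "ip x (y - z) = ip x y - ip x z"
  using ip_add_right[of x "y - z" z] by simp

text \<open>
  This is the real part of the inner product, recovered from the norm by polarisation because
  an abstract scalar field comes without a real-part map.
\<close>

definition rip :: "'h \<Rightarrow> 'h \<Rightarrow> real"
  where "rip x y = ((norm (x + y))\<^sup>2 - (norm (x - y))\<^sup>2) / 4"

lemma of_real_rip: "of_real (2 * rip x y) = ip x y + ip y x"
proof -
  have "2 * of_real (2 * rip x y) = (of_real ((norm (x + y))\<^sup>2 - (norm (x - y))\<^sup>2) :: 'k)"
    by (simp add: rip_def)
  also have "\<dots> = ip (x + y) (x + y) - ip (x - y) (x - y)"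
    by (simp only: of_real_diff ip_self)
  also have "\<dots> = 2 * (ip x y + ip y x)"
    by (simp add: ip_add_left ip_add_right ip_diff_left ip_diff_right)
  finally show ?thesis
    by (metis mult_cancel_left zero_neq_numeral)
qed

lemma rip_eqI: "ip x y + ip y x = of_real (2 * r) \<Longrightarrow> rip x y = r"
  using of_real_rip[of x y] by (simp del: of_real_mult)

sublocale re: real_hilbert rip
proof
  fix x y z r
  show "rip (x + y) z = rip x z + rip y z"
    using of_real_rip[of x z] of_real_rip[of y z]
    by (intro rip_eqI) (simp add: ip_add_left ip_add_right algebra_simps)
  show "rip (r *\<^sub>R x) y = r * rip x y"
    using arg_cong[OF of_real_rip[of x y], of "\<lambda>t. of_real r * t"]
    by (intro rip_eqI) (simp add: ip_scaleR_left ip_scaleR_right algebra_simps)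
  show "rip x y = rip y x"
    by (simp add: rip_def add.commute norm_minus_commute)
  show "rip x x = (norm x)\<^sup>2"
    by (intro rip_eqI) (simp add: ip_self)
qed

lemma norm_smul: "norm (smul c x) = norm c * norm x"
proof -
  have "of_real ((norm (smul c x))\<^sup>2) = (c * conjg c) * ip x x"
    by (simp only: ip_self[symmetric] ip_scale_left ip_scale_right mult_ac)
  also have "\<dots> = of_real ((norm c * norm x)\<^sup>2)"
    by (simp add: mult_conjg_of_real ip_self power_mult_distrib)
  finally have "(norm (smul c x))\<^sup>2 = (norm c * norm x)\<^sup>2"
    by (simp only: of_real_eq_iff)
  then show ?thesis
    by (rule power2_eq_imp_eq) simp_all
qed

lemma bounded_linear_smul: "bounded_linear (smul c)"
proof (rule bounded_linear_intro[where K = "norm c"])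
  show "smul c (r *\<^sub>R x) = r *\<^sub>R smul c x" for r x
    by (simp add: scale_of_real[symmetric] mult.commute)
qed (simp_all add: scale_right_distrib norm_smul mult.commute)

text \<open>
  Symmetry of the real part, applied to \<open>cx\<close>, says that the real part of \<open>cd\<close> vanishes,
  where \<open>d\<close> is the defect \<open>\<langle>Tx,y\<rangle> - \<langle>x,Ty\<rangle>\<close>. The choice of \<open>c\<close> as the conjugate of \<open>d\<close>
  turns this into \<open>\<bar>d\<bar>\<^sup>2 = 0\<close>.
\<close>

lemma ip_symmetric:
  assumes sym: "re.symmetric T" and lin: "\<And>c x. T (smul c x) = smul c (T x)"
  shows "ip (T x) y = ip x (T y)"
proof -
  define d where "d = ip (T x) y - ip x (T y)"
  define c where "c = conjg d"
  have "rip (T (smul c x)) y = rip (smul c x) (T y)"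
    using sym by (simp add: re.symmetric_def)
  then have "ip (smul c (T x)) y + ip y (smul c (T x)) =
      ip (smul c x) (T y) + ip (T y) (smul c x)"
    by (metis of_real_rip lin)
  then have "c * ip (T x) y + conjg (c * ip (T x) y) = c * ip x (T y) + conjg (c * ip x (T y))"
    by (simp add: ip_scale_left ip_scale_right conjg_mult ip_commute[of "T x" y]
        ip_commute[of x "T y"] conjg_conjg)
  moreover have "conjg (c * ip (T x) y) = conjg (c * d) + conjg (c * ip x (T y))"
    by (simp add: d_def conjg_add[symmetric] distrib_left[symmetric])
  ultimately have "c * d + conjg (c * d) = 0"
    by (simp add: d_def algebra_simps)
  moreover have "c * d = of_real ((norm d)\<^sup>2)"
    using mult_conjg_of_real[of d] by (simp add: c_def mult.commute)
  ultimately have "of_real (2 * (norm d)\<^sup>2) = (0 :: 'k)"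
    by (simp add: conjg_of_real del: of_real_power)
  then have "d = 0"
    by (simp del: of_real_mult of_real_power)
  then show ?thesis by (simp add: d_def)
qed

text \<open>
  The rank-one operators \<open>x \<mapsto> \<langle>x,f\<rangle>f\<close> are the summands of the frame operator. They are symmetric and
  positive for the real part, with quadratic form \<open>\<bar>\<langle>x,f\<rangle>\<bar>\<^sup>2\<close>, and these properties pass to the sum.
\<close>

lemma two_rip_rank_one:
  "of_real (2 * rip (smul (ip x f) f) y) = ip x f * conjg (ip y f) + conjg (ip x f) * ip y f"
  by (simp only: of_real_rip ip_scale_left ip_scale_right ip_commute[of f y])

lemma rip_rank_one_commute: "rip (smul (ip x f) f) y = rip (smul (ip y f) f) x"
proof -
  have "(of_real (2 * rip (smul (ip x f) f) y) :: 'k) = of_real (2 * rip (smul (ip y f) f) x)"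
    unfolding two_rip_rank_one by (simp only: mult.commute add.commute)
  then show ?thesis by (simp only: of_real_eq_iff)
qed

lemma rip_rank_one_self: "rip (smul (ip x f) f) x = (norm (ip x f))\<^sup>2"
proof -
  have "of_real (2 * rip (smul (ip x f) f) x) = (of_real (2 * (norm (ip x f))\<^sup>2) :: 'k)"
    using mult_conjg_of_real[of "ip x f"] unfolding two_rip_rank_one by (simp add: mult.commute)
  then show ?thesis by (simp only: of_real_eq_iff)
qed

lemma rip_rank_one_le: "rip (smul (ip x f) f) y \<le> norm (ip x f) * norm (ip y f)"
proof -
  have "\<bar>2 * rip (smul (ip x f) f) y\<bar> = norm (of_real (2 * rip (smul (ip x f) f) y) :: 'k)"
    by (simp only: norm_of_real)
  also have "\<dots> \<le> norm (ip x f) * norm (ip y f) + norm (ip x f) * norm (ip y f)"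
    unfolding two_rip_rank_one
    by (rule order_trans[OF norm_triangle_ineq]) (simp add: norm_mult norm_conjg)
  finally show ?thesis by linarith
qed

end

section \<open>The frame operator\<close>

locale hilbert_frame = hilbert_space smul ip
  for smul :: "'k::rc_scalar \<Rightarrow> 'h::banach \<Rightarrow> 'h" and ip :: "'h \<Rightarrow> 'h \<Rightarrow> 'k" +
  fixes I :: "'i set" and \<phi> :: "'i \<Rightarrow> 'h" and A B :: real
  assumes frame: "frame_with_bounds ip I \<phi> A B"
begin

abbreviation S :: "'h \<Rightarrow> 'h"
  where "S \<equiv> frame_operator smul ip I \<phi>"

lemma bounds_pos: "A > 0" "B > 0"
  using frame by (auto simp: frame_with_bounds_def)

lemma coeff_summable: "(\<lambda>i. (norm (ip x (\<phi> i)))\<^sup>2) summable_on I"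
  and coeff_lower: "A * (norm x)\<^sup>2 \<le> (\<Sum>\<^sub>\<infinity>i\<in>I. (norm (ip x (\<phi> i)))\<^sup>2)"
  and coeff_upper: "(\<Sum>\<^sub>\<infinity>i\<in>I. (norm (ip x (\<phi> i)))\<^sup>2) \<le> B * (norm x)\<^sup>2"
  using frame by (auto simp: frame_with_bounds_def)

lemma coeff_finite_le:
  assumes "finite F" "F \<subseteq> I"
  shows "(\<Sum>i\<in>F. (norm (ip x (\<phi> i)))\<^sup>2) \<le> B * (norm x)\<^sup>2"
  by (rule order_trans[OF finite_sum_le_infsum[OF coeff_summable assms] coeff_upper]) simp

text \<open>
  Pairing the partial sum \<open>v\<close> with itself and applying Cauchy--Schwarz in \<open>\<ell>\<^sup>2\<close> bounds
  \<open>\<parallel>v\<parallel>\<^sup>2\<close> by the coefficients of \<open>x\<close> times those of \<open>v\<close>; the latter are at most \<open>sqrt B \<parallel>v\<parallel>\<close>.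
\<close>

lemma norm_partial_sum_le:
  assumes F: "finite F" "F \<subseteq> I"
  shows "(norm (\<Sum>i\<in>F. smul (ip x (\<phi> i)) (\<phi> i)))\<^sup>2 \<le> B * (\<Sum>i\<in>F. (norm (ip x (\<phi> i)))\<^sup>2)"
proof -
  define v where "v = (\<Sum>i\<in>F. smul (ip x (\<phi> i)) (\<phi> i))"
  define a where "a = L2_set (\<lambda>i. norm (ip x (\<phi> i))) F"
  have "(norm v)\<^sup>2 = rip v v" by (simp add: re.self)
  also have "\<dots> = (\<Sum>i\<in>F. rip (smul (ip x (\<phi> i)) (\<phi> i)) v)"
    using linear_sum[OF bounded_linear.linear[OF re.bounded_linear_left]] by (subst v_def) blast
  also have "\<dots> \<le> (\<Sum>i\<in>F. \<bar>norm (ip x (\<phi> i))\<bar> * \<bar>norm (ip v (\<phi> i))\<bar>)"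
    by (intro sum_mono) (simp add: rip_rank_one_le)
  also have "\<dots> \<le> a * L2_set (\<lambda>i. norm (ip v (\<phi> i))) F"
    unfolding a_def by (rule L2_set_mult_ineq)
  also have "L2_set (\<lambda>i. norm (ip v (\<phi> i))) F \<le> sqrt B * norm v"
    unfolding L2_set_def using real_sqrt_le_mono[OF coeff_finite_le[OF F, of v]]
    by (simp add: real_sqrt_mult)
  finally have *: "(norm v)\<^sup>2 \<le> a * (sqrt B * norm v)"
    by (simp add: a_def mult_left_mono)
  have "norm v \<le> sqrt B * a"
  proof (cases "v = 0")
    case False
    have "norm v * norm v \<le> (sqrt B * a) * norm v"
      using * by (simp add: power2_eq_square mult_ac)
    with False show ?thesis by simp
  qed (use bounds_pos in \<open>simp add: a_def\<close>)
  then have "(norm v)\<^sup>2 \<le> (sqrt B * a)\<^sup>2"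
    by (intro power_mono) simp_all
  also have "\<dots> = B * (\<Sum>i\<in>F. (norm (ip x (\<phi> i)))\<^sup>2)"
    using bounds_pos by (simp add: power_mult_distrib a_def L2_set_def sum_nonneg)
  finally show ?thesis by (simp add: v_def)
qed

lemma frame_operator_has_sum: "((\<lambda>i. smul (ip x (\<phi> i)) (\<phi> i)) has_sum S x) I"
proof -
  let ?c = "\<lambda>i. (norm (ip x (\<phi> i)))\<^sup>2"
  have "(\<lambda>i. smul (ip x (\<phi> i)) (\<phi> i)) summable_on I"
  proof (rule summable_on_banach_CauchyI)
    fix e :: real assume e: "e > 0"
    obtain F0 where F0: "finite F0" "F0 \<subseteq> I" "dist (sum ?c F0) (infsum ?c I) \<le> e\<^sup>2 / (2 * B)"
      using has_sum_finite_approximation[OF has_sum_infsum[OF coeff_summable], of "e\<^sup>2 / (2 * B)"]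
        e bounds_pos by auto
    have "norm (\<Sum>i\<in>F. smul (ip x (\<phi> i)) (\<phi> i)) < e" if F: "finite F" "F \<subseteq> I - F0" for F
    proof -
      have "sum ?c F0 + sum ?c F = sum ?c (F0 \<union> F)"
        using F F0 by (intro sum.union_disjoint[symmetric]) auto
      also have "\<dots> \<le> infsum ?c I"
        using F F0 by (intro finite_sum_le_infsum coeff_summable) auto
      finally have "sum ?c F \<le> e\<^sup>2 / (2 * B)"
        using F0(3) by (simp add: dist_real_def abs_le_iff)
      then have "B * sum ?c F \<le> B * (e\<^sup>2 / (2 * B))"
        using bounds_pos by (intro mult_left_mono) auto
      also have "\<dots> < e\<^sup>2"
        using bounds_pos e by simp
      finally have "(norm (\<Sum>i\<in>F. smul (ip x (\<phi> i)) (\<phi> i)))\<^sup>2 < e\<^sup>2"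
        using F by (intro order_le_less_trans[OF norm_partial_sum_le]) auto
      then show ?thesis
        by (rule power2_less_imp_less) (use e in simp)
    qed
    with F0 show "\<exists>F0. finite F0 \<and> F0 \<subseteq> I \<and> (\<forall>F. finite F \<longrightarrow> F \<subseteq> I - F0 \<longrightarrow>
        norm (\<Sum>i\<in>F. smul (ip x (\<phi> i)) (\<phi> i)) < e)"
      by blast
  qed
  then show ?thesis
    by (simp add: frame_operator_def)
qed

lemma rip_frame_operator_has_sum:
  "((\<lambda>i. rip (smul (ip x (\<phi> i)) (\<phi> i)) y) has_sum rip (S x) y) I"
  by (rule has_sum_bounded_linear[OF re.bounded_linear_left frame_operator_has_sum])

lemma rip_frame_operator_self: "rip (S x) x = (\<Sum>\<^sub>\<infinity>i\<in>I. (norm (ip x (\<phi> i)))\<^sup>2)"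
  using rip_frame_operator_has_sum[of x x] by (simp add: rip_rank_one_self infsumI)

lemma frame_operator_coercive: "re.coercive A S"
  using coeff_lower bounds_pos by (simp add: re.coercive_def rip_frame_operator_self)

lemma frame_operator_symmetric: "re.symmetric S"
  unfolding re.symmetric_def
proof (intro allI)
  fix x y
  have "((\<lambda>i. rip (smul (ip x (\<phi> i)) (\<phi> i)) y) has_sum rip (S y) x) I"
    using rip_frame_operator_has_sum[of y x] by (simp add: rip_rank_one_commute)
  then show "rip (S x) y = rip x (S y)"
    using rip_frame_operator_has_sum[of x y] has_sum_unique by (metis re.commute)
qed

lemma frame_operator_smul: "S (smul c x) = smul c (S x)"
proof -
  have "((\<lambda>i. smul (ip (smul c x) (\<phi> i)) (\<phi> i)) has_sum smul c (S x)) I"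
    using has_sum_bounded_linear[OF bounded_linear_smul frame_operator_has_sum]
    by (simp add: ip_scale_left)
  then show ?thesis
    using frame_operator_has_sum has_sum_unique by blast
qed

lemma frame_operator_bounded_linear: "bounded_linear S"
proof (rule bounded_linear_intro[where K = B])
  show "S (x + y) = S x + S y" for x y
  proof -
    have "((\<lambda>i. smul (ip (x + y) (\<phi> i)) (\<phi> i)) has_sum S x + S y) I"
      using has_sum_add[OF frame_operator_has_sum frame_operator_has_sum]
      by (simp add: ip_add_left scale_left_distrib)
    then show ?thesis
      using frame_operator_has_sum has_sum_unique by blast
  qed
  show "S (r *\<^sub>R x) = r *\<^sub>R S x" for r x
    by (simp add: scale_of_real[symmetric] frame_operator_smul)
  show "norm (S x) \<le> norm x * B" for x
  proof -
    have "rip (S x) (S x) \<le> (B * norm x) * norm (S x)"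
    proof (rule has_sum_le_finite_sums[OF rip_frame_operator_has_sum])
      fix F assume F: "finite F" "F \<subseteq> I"
      let ?v = "\<Sum>i\<in>F. smul (ip x (\<phi> i)) (\<phi> i)"
      have "(norm ?v)\<^sup>2 \<le> B * (B * (norm x)\<^sup>2)"
        using norm_partial_sum_le[OF F, of x] mult_left_mono[OF coeff_finite_le[OF F, of x], of B]
          bounds_pos by linarith
      then have "(norm ?v)\<^sup>2 \<le> (B * norm x)\<^sup>2"
        by (simp add: power2_eq_square mult_ac)
      then have v: "norm ?v \<le> B * norm x"
        by (rule power2_le_imp_le) (use bounds_pos in simp)
      have "(\<Sum>i\<in>F. rip (smul (ip x (\<phi> i)) (\<phi> i)) (S x)) = rip ?v (S x)"
        using linear_sum[OF bounded_linear.linear[OF re.bounded_linear_left]] by metis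
      also have "\<dots> \<le> norm ?v * norm (S x)"
        using re.cauchy_schwarz[of ?v "S x"] by linarith
      also have "\<dots> \<le> (B * norm x) * norm (S x)"
        using v by (intro mult_right_mono) auto
      finally show "(\<Sum>i\<in>F. rip (smul (ip x (\<phi> i)) (\<phi> i)) (S x)) \<le> (B * norm x) * norm (S x)" .
    qed
    then have "norm (S x) * norm (S x) \<le> (norm x * B) * norm (S x)"
      by (simp add: re.self power2_eq_square mult_ac)
    then show ?thesis
      using bounds_pos by (cases "S x = 0") auto
  qed
qed

lemma frame_operator_bij: "bij S"
  by (rule re.coercive_bij[OF frame_operator_bounded_linear frame_operator_coercive])

lemma inv_frame_operator_smul: "inv S (smul c x) = smul c (inv S x)"
proof -
  have "S (smul c (inv S x)) = smul c x"
    using frame_operator_bij by (simp add: frame_operator_smul bij_is_surj surj_f_inv_f)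
  then show ?thesis
    using frame_operator_bij by (metis bij_is_inj inv_f_f)
qed

section \<open>Weaving a frame with its symmetric images\<close>

text \<open>
  Put \<open>a\<^sub>i = \<bar>\<langle>x,\<phi>\<^sub>i\<rangle>\<bar>\<close> and \<open>b\<^sub>i = \<bar>\<langle>Ux,\<phi>\<^sub>i\<rangle>\<bar>\<close>; symmetry of \<open>U\<close> makes \<open>b\<^sub>i\<close> the size of the
  coefficient of \<open>x\<close> with respect to \<open>U\<phi>\<^sub>i\<close>. A woven family retains, for each index, one factor
  of the product \<open>a\<^sub>i b\<^sub>i\<close>, and these products add up to at least \<open>\<langle>Sx,Ux\<rangle> \<ge> \<delta>\<parallel>x\<parallel>\<^sup>2\<close>. Whichever
  factor is retained, \<open>2\<epsilon> a\<^sub>i b\<^sub>i\<close> is at most its square plus \<open>\<epsilon>\<^sup>2 (a\<^sub>i\<^sup>2 + b\<^sub>i\<^sup>2)\<close>, and for small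
  \<open>\<epsilon>\<close> the last term is absorbed by the upper frame bound. The selection \<open>\<sigma>\<close> does not enter the
  constants.
\<close>

lemma woven_symmetric_image:
  assumes U: "bounded_linear U" and sym: "\<And>x y. ip (U x) y = ip x (U y)"
    and \<delta>: "\<delta> > 0" "\<And>x. \<delta> * (norm x)\<^sup>2 \<le> rip (S x) (U x)"
  shows "woven ip I \<phi> (\<lambda>i. U (\<phi> i))"
proof -
  obtain K where K: "K > 0" "\<And>x. norm (U x) \<le> norm x * K"
    using bounded_linear.pos_bounded[OF U] by blast
  (* C bounds both coefficient families together; \<epsilon> C = \<delta> lets the error term absorb exactly half. *)
  define C where "C = B * (1 + K\<^sup>2)"
  define \<epsilon> where "\<epsilon> = \<delta> / C"
  have C: "C > 0"
    using bounds_pos K by (simp add: C_def add_pos_nonneg)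
  have \<epsilon>: "\<epsilon> > 0" "\<epsilon> * C = \<delta>"
    using \<delta> C by (auto simp: \<epsilon>_def)
  (* On the zero space \<epsilon> \<delta> may exceed C, hence the minimum. *)
  have "frame_with_bounds ip I (\<lambda>i. if i \<in> \<sigma> then \<phi> i else U (\<phi> i)) (min (\<epsilon> * \<delta>) C) C" for \<sigma>
    unfolding frame_with_bounds_def
  proof (intro conjI allI)
    show "0 < min (\<epsilon> * \<delta>) C" "min (\<epsilon> * \<delta>) C \<le> C"
      using \<epsilon> \<delta> C by auto
    fix x
    define a b w where "a i = norm (ip x (\<phi> i))" and "b i = norm (ip (U x) (\<phi> i))"
      and "w i = (norm (ip x (if i \<in> \<sigma> then \<phi> i else U (\<phi> i))))\<^sup>2" for i
    have w: "w i = (if i \<in> \<sigma> then (a i)\<^sup>2 else (b i)\<^sup>2)" for i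
      by (simp add: w_def a_def b_def sym)
    have sum_ab: "(\<lambda>i. (a i)\<^sup>2 + (b i)\<^sup>2) summable_on I"
      unfolding a_def b_def by (intro summable_on_add coeff_summable)
    have "(\<Sum>\<^sub>\<infinity>i\<in>I. (a i)\<^sup>2 + (b i)\<^sup>2) = (\<Sum>\<^sub>\<infinity>i\<in>I. (a i)\<^sup>2) + (\<Sum>\<^sub>\<infinity>i\<in>I. (b i)\<^sup>2)"
      unfolding a_def b_def by (intro infsum_add coeff_summable)
    also have "\<dots> \<le> B * (norm x)\<^sup>2 + B * (norm (U x))\<^sup>2"
      unfolding a_def b_def by (intro add_mono coeff_upper)
    also have "\<dots> \<le> B * (norm x)\<^sup>2 + B * (norm x * K)\<^sup>2"
      using K bounds_pos by (intro add_mono mult_left_mono power_mono) auto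
    also have "\<dots> = C * (norm x)\<^sup>2"
      by (simp add: C_def algebra_simps power_mult_distrib)
    finally have total: "(\<Sum>\<^sub>\<infinity>i\<in>I. (a i)\<^sup>2 + (b i)\<^sup>2) \<le> C * (norm x)\<^sup>2" .
    have sum_w: "w summable_on I"
      using sum_ab by (rule summable_on_comparison_test) (auto simp: w)
    then show "(\<lambda>i. (norm (ip x (if i \<in> \<sigma> then \<phi> i else U (\<phi> i))))\<^sup>2) summable_on I"
      by (simp add: w_def[abs_def])
    have "infsum w I \<le> (\<Sum>\<^sub>\<infinity>i\<in>I. (a i)\<^sup>2 + (b i)\<^sup>2)"
      by (rule infsum_mono[OF sum_w sum_ab]) (simp add: w)
    with total show "(\<Sum>\<^sub>\<infinity>i\<in>I. (norm (ip x (if i \<in> \<sigma> then \<phi> i else U (\<phi> i))))\<^sup>2) \<le> C * (norm x)\<^sup>2"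
      by (simp add: w_def[abs_def])
    have pointwise: "2 * \<epsilon> * rip (smul (ip x (\<phi> i)) (\<phi> i)) (U x) \<le> w i + \<epsilon>\<^sup>2 * ((a i)\<^sup>2 + (b i)\<^sup>2)" for i
    proof -
      have "2 * \<epsilon> * rip (smul (ip x (\<phi> i)) (\<phi> i)) (U x) \<le> 2 * \<epsilon> * (a i * b i)"
        using \<epsilon> rip_rank_one_le[of x "\<phi> i" "U x"]
        by (intro mult_left_mono) (auto simp: a_def b_def)
      also have "\<dots> \<le> w i + \<epsilon>\<^sup>2 * ((a i)\<^sup>2 + (b i)\<^sup>2)"
      proof -
        have "0 \<le> (a i - \<epsilon> * b i)\<^sup>2" "0 \<le> (b i - \<epsilon> * a i)\<^sup>2"
          "0 \<le> \<epsilon>\<^sup>2 * (a i)\<^sup>2" "0 \<le> \<epsilon>\<^sup>2 * (b i)\<^sup>2" by simp_all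
        then show ?thesis
          by (cases "i \<in> \<sigma>") (simp_all add: w power2_diff power_mult_distrib algebra_simps power2_eq_square)
      qed
      finally show ?thesis .
    qed
    have "2 * \<epsilon> * (\<delta> * (norm x)\<^sup>2) \<le> 2 * \<epsilon> * rip (S x) (U x)"
      using \<delta> \<epsilon> by (intro mult_left_mono) auto
    also have "\<dots> \<le> infsum w I + \<epsilon>\<^sup>2 * (\<Sum>\<^sub>\<infinity>i\<in>I. (a i)\<^sup>2 + (b i)\<^sup>2)"
      by (rule has_sum_mono[OF has_sum_cmult_right[OF rip_frame_operator_has_sum]
            has_sum_add[OF has_sum_infsum[OF sum_w]
              has_sum_cmult_right[OF has_sum_infsum[OF sum_ab]]] pointwise])
    also have "\<dots> \<le> infsum w I + \<epsilon>\<^sup>2 * (C * (norm x)\<^sup>2)"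
      using total by (intro add_left_mono mult_left_mono) auto
    also have "\<epsilon>\<^sup>2 * (C * (norm x)\<^sup>2) = \<epsilon> * \<delta> * (norm x)\<^sup>2"
      by (simp add: \<epsilon>(2)[symmetric] power2_eq_square mult_ac)
    finally have "\<epsilon> * \<delta> * (norm x)\<^sup>2 \<le> infsum w I"
      by (simp add: mult_ac)
    moreover have "min (\<epsilon> * \<delta>) C * (norm x)\<^sup>2 \<le> \<epsilon> * \<delta> * (norm x)\<^sup>2"
      by (intro mult_right_mono) auto
    ultimately show "min (\<epsilon> * \<delta>) C * (norm x)\<^sup>2 \<le>
        (\<Sum>\<^sub>\<infinity>i\<in>I. (norm (ip x (if i \<in> \<sigma> then \<phi> i else U (\<phi> i))))\<^sup>2)"
      by (simp add: w_def[abs_def])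
  qed
  moreover have "0 < min (\<epsilon> * \<delta>) C" "min (\<epsilon> * \<delta>) C \<le> C"
    using \<epsilon> \<delta> C by auto
  ultimately show ?thesis
    unfolding woven_def by blast
qed

lemma woven_scaled_symmetric_image:
  assumes U: "bounded_linear U" and sym: "\<And>x y. ip (U x) y = ip x (U y)"
    and \<delta>: "\<delta> > 0" "\<And>x. \<delta> * (norm x)\<^sup>2 \<le> rip (S x) (U x)" and c: "c > 0"
  shows "woven ip I \<phi> (\<lambda>i. c *\<^sub>R U (\<phi> i))"
proof (rule woven_symmetric_image[where \<delta> = "c * \<delta>"])
  show "bounded_linear (\<lambda>x. c *\<^sub>R U x)"
    by (rule bounded_linear_compose[OF bounded_linear_scaleR_right U])
  show "ip (c *\<^sub>R U x) y = ip x (c *\<^sub>R U y)" for x y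
    by (simp add: ip_scaleR_left ip_scaleR_right sym)
  show "c * \<delta> * (norm x)\<^sup>2 \<le> rip (S x) (c *\<^sub>R U x)" for x
    using mult_left_mono[OF \<delta>(2)[of x], of c] c by (simp add: re.scaleR_right)
qed (use \<delta> c in simp)

lemma woven_scaled_canonical_dual:
  assumes "c > 0"
  shows "woven ip I \<phi> (\<lambda>i. c *\<^sub>R inv S (\<phi> i))"
proof (rule woven_scaled_symmetric_image[where \<delta> = 1])
  show "bounded_linear (inv S)"
    by (rule re.bounded_linear_inv_coercive[OF frame_operator_bounded_linear frame_operator_coercive])
  show "ip (inv S x) y = ip x (inv S y)" for x y
    by (rule ip_symmetric[OF _ inv_frame_operator_smul])
      (intro re.symmetric_inv frame_operator_symmetric bij_is_surj frame_operator_bij)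
  show "1 * (norm x)\<^sup>2 \<le> rip (S x) (inv S x)" for x
  proof -
    have "rip (S x) (inv S x) = rip x (S (inv S x))"
      using frame_operator_symmetric by (simp add: re.symmetric_def)
    then show ?thesis
      using frame_operator_bij by (simp add: bij_is_surj surj_f_inv_f re.self)
  qed
qed (use assms in auto)

text \<open>
  For \<open>R = S\<^sup>-\<^sup>1\<^sup>/\<^sup>2\<close> the vector \<open>y = Sx\<close> satisfies \<open>x = R (R y)\<close>, whence \<open>\<langle>Sx,Rx\<rangle> = \<langle>R(Ry),Ry\<rangle>\<close>, which is
  bounded below by a multiple of \<open>\<parallel>Ry\<parallel>\<^sup>2\<close>, hence by one of \<open>\<parallel>x\<parallel>\<^sup>2\<close>.
\<close>

lemma woven_scaled_canonical_parseval:
  assumes "c > 0"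
  shows "woven ip I \<phi> (\<lambda>i. c *\<^sub>R positive_sqrt smul ip (inv S) (\<phi> i))"
proof -
  note S = frame_operator_bounded_linear frame_operator_coercive
  have surj: "surj S" and inj: "inj S"
    using frame_operator_bij by (auto simp: bij_def)
  have inv_bl: "bounded_linear (inv S)"
    by (rule re.bounded_linear_inv_coercive[OF S])
  have inv_sym: "re.symmetric (inv S)"
    by (rule re.symmetric_inv[OF frame_operator_symmetric surj])
  obtain \<delta> where inv_co: "re.coercive \<delta> (inv S)"
    by (rule re.coercive_inv[OF S])
  obtain R \<epsilon> where R: "bounded_linear R" "re.coercive \<epsilon> R" "re.symmetric R" "R \<circ> R = inv S"
    and comm: "\<And>W. bounded_linear W \<Longrightarrow> W \<circ> inv S = inv S \<circ> W \<Longrightarrow> W \<circ> R = R \<circ> W"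
    using re.coercive_sqrt_exists[OF inv_bl inv_co inv_sym] by blast
  have \<epsilon>: "\<epsilon> > 0" "\<And>x. \<epsilon> * (norm x)\<^sup>2 \<le> rip (R x) x"
    using R(2) by (auto simp: re.coercive_def)
  have R_smul: "R (smul k x) = smul k (R x)" for k x
  proof -
    have "smul k \<circ> R = R \<circ> smul k"
      by (rule comm[OF bounded_linear_smul]) (simp add: fun_eq_iff inv_frame_operator_smul)
    then show ?thesis by (metis comp_apply)
  qed
  have R_sym: "ip (R x) y = ip x (R y)" for x y
    by (rule ip_symmetric[OF R(3) R_smul])
  have "positive_operator smul ip R"
    unfolding positive_operator_def
  proof (intro conjI allI R(1) R_smul R_sym)
    fix x
    have "2 * ip (R x) x = of_real (2 * rip (R x) x)"
      by (simp only: of_real_rip R_sym) simp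
    then have "ip (R x) x = of_real (rip (R x) x)" by simp
    moreover have "0 \<le> rip (R x) x"
      using \<epsilon>(1) \<epsilon>(2)[of x] by (smt (verit) mult_nonneg_nonneg zero_le_power2)
    ultimately show "\<exists>r\<ge>0. ip (R x) x = of_real r" by blast
  qed
  moreover have "Q = R" if Q: "positive_operator smul ip Q" "Q \<circ> Q = inv S" for Q
  proof (rule re.coercive_sqrt_unique[OF R(1,2,4) comm _ _ Q(2)])
    show "bounded_linear Q" using Q(1) by (simp add: positive_operator_def)
    fix x
    have "\<exists>r\<ge>0. ip (Q x) x = of_real r"
      using Q(1) unfolding positive_operator_def by blast
    then obtain r where r: "r \<ge> 0" "ip (Q x) x = of_real r" by blast
    moreover have "ip x (Q x) = ip (Q x) x"
      using Q(1) by (simp add: positive_operator_def)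
    ultimately have "rip (Q x) x = r"
      by (intro rip_eqI) simp
    with r show "0 \<le> rip (Q x) x" by simp
  qed
  ultimately have root: "positive_sqrt smul ip (inv S) = R"
    unfolding positive_sqrt_def using R(4) by (intro the_equality conjI) blast+
  obtain K where K: "K > 0" "\<And>x. norm (R x) \<le> norm x * K"
    using bounded_linear.pos_bounded[OF R(1)] by blast
  have "(\<epsilon> / K\<^sup>2) * (norm x)\<^sup>2 \<le> rip (S x) (R x)" for x
  proof -
    define z where "z = R (S x)"
    have "R z = inv S (S x)"
      using R(4) by (metis comp_apply z_def)
    then have x: "R z = x"
      using inj by simp
    have "(norm x)\<^sup>2 \<le> (norm z * K)\<^sup>2"
      using K(2)[of z] by (intro power_mono) (simp_all add: x)
    then have "(\<epsilon> / K\<^sup>2) * (norm x)\<^sup>2 \<le> (\<epsilon> / K\<^sup>2) * (norm z * K)\<^sup>2"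
      using \<epsilon> by (intro mult_left_mono) simp_all
    also have "\<dots> = \<epsilon> * (norm z)\<^sup>2"
      using K(1) by (simp add: power_mult_distrib)
    also have "\<dots> \<le> rip (R z) z"
      by (rule \<epsilon>(2))
    also have "rip (R z) z = rip (S x) (R x)"
      using R(3) unfolding x by (simp add: re.symmetric_def z_def re.commute[of x])
    finally show ?thesis .
  qed
  then show ?thesis
    unfolding root using \<epsilon> K assms
    by (intro woven_scaled_symmetric_image[where \<delta> = "\<epsilon> / K\<^sup>2"] R(1) R_sym) auto
qed

end

section \<open>The weaving theorem\<close>

theorem corollary6p3:
  fixes smul :: "'k::rc_scalar \<Rightarrow> 'h::banach \<Rightarrow> 'h"
    and ip :: "'h \<Rightarrow> 'h \<Rightarrow> 'k"
    and I :: "'i set"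
    and \<phi> :: "'i \<Rightarrow> 'h"
    and A B :: real
  assumes "hilbert_space smul ip"
    and "countable I"
    and "frame_with_bounds ip I \<phi> A B"
    and "B / A < 2"
  shows "woven ip I \<phi>
           (\<lambda>i. (2 * A * B / (A + B)) *\<^sub>R inv (frame_operator smul ip I \<phi>) (\<phi> i)) \<and>
         woven ip I \<phi>
           (\<lambda>i. (2 * sqrt (A * B) / (sqrt A + sqrt B)) *\<^sub>R
              positive_sqrt smul ip (inv (frame_operator smul ip I \<phi>)) (\<phi> i))"
proof -
  interpret hilbert_space smul ip by fact
  interpret hilbert_frame smul ip I \<phi> A B by unfold_locales fact
  show ?thesis
    using bounds_pos
    by (intro conjI woven_scaled_canonical_dual woven_scaled_canonical_parseval)
      (simp_all add: add_pos_pos)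
qed

end
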